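(* Let $0<\varepsilon\le RL$ and let the noise be independent and Gaussian, $e_k\sim N(0,s^2)$. Every algorithm (adaptive and possibly randomized) making $N$ queries to the stochastic subgradient oracle satisfies, with $K:=\varepsilon^2N/(2R^2s^2)$, $$\mathcal E_N\;\le\;K+\sqrt{6K}+\log 6 .$$
   Context: Let $x_0\in\mathbb R$, $R,L,s>0$, $N\ge1$. Let $\mathcal C=\mathcal C(R,L)$ be the class of convex (possibly nonsmooth) functions $f:\mathbb R\to\mathbb R$ admitting a minimizer $x_\star$ with $|x_0-x_\star|\le R$ and all of whose subgradients at all points are bounded by $L$ in absolute value; write $f_\star=f(x_\star)$. Oracle and algorithms: for an instance $f$ the oracle uses a measurable selection $x\mapsto g(x)\in\partial f(x)$. The algorithm may use internal randomness $\omega$, drawn before the run independently of the noise. For $k=0,\dots,N-1$ it queries a point $x_k$ that is a measurable function of $\omega$ and the previous answers $\tilde g_0,\dots,\tilde g_{k-1}$ (with $x_0$ the starting point), and receives $\tilde g_k=g(x_k)+e_k$. After $N$ queries it returns $x_A$, a measurable function of $\omega,\tilde g_0,\dots,\tilde g_{N-1}$. Here the noise variables $e_0,\dots,e_{N-1}$ are i.i.d. $N(0,s^2)$ and independent of $\omega$, and $$\mathcal E_N=-\log\,\sup_{f}\ \mathbb P\big(f(x_A)-f_\star\ge\varepsilon\big),$$ the supremum running over all $f\in\mathcal C$ together with all measurable subgradient selections of the oracle. Logarithms are natural. *)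

theory Defs
  imports "HOL-Probability.Probability"
begin

definition subdifferential :: "(real \<Rightarrow> real) \<Rightarrow> real \<Rightarrow> real set" where
  "subdifferential f x = {v. \<forall>y. f y \<ge> f x + v * (y - x)}"

definition min_value :: "(real \<Rightarrow> real) \<Rightarrow> real" where
  "min_value f = f (arg_min f (\<lambda>_. True))"

definition problem_class :: "real \<Rightarrow> real \<Rightarrow> real \<Rightarrow> (real \<Rightarrow> real) set" where
  "problem_class x0 R L = {f. convex_on UNIV f \<and>
     (\<exists>xs. is_arg_min f (\<lambda>_. True) xs \<and> \<bar>x0 - xs\<bar> \<le> R) \<and>
     (\<forall>x. \<forall>v\<in>subdifferential f x. \<bar>v\<bar> \<le> L)}"

definition subgradient_selection :: "(real \<Rightarrow> real) \<Rightarrow> (real \<Rightarrow> real) \<Rightarrow> bool" where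
  "subgradient_selection f g \<longleftrightarrow>
     g \<in> borel_measurable borel \<and> (\<forall>x. g x \<in> subdifferential f x)"

text \<open>A finite tuple of answers indexed by \<open>{..<k}\<close> is an element of
  \<open>space (\<Pi>\<^sub>M j\<in>{..<k}. borel)\<close>, i.e. a function on \<^typ>\<open>nat\<close> that is \<^term>\<open>undefined\<close>
  outside \<open>{..<k}\<close>; so \<open>\<lambda>_. undefined\<close> is the empty tuple.\<close>

type_synonym answers = "nat \<Rightarrow> real"

text \<open>The algorithm is given by its query rules \<open>q k\<close> and its output rule \<open>out\<close>, both acting on the
  internal randomness, which ranges over the arbitrary measurable space \<open>\<Omega>\<close>, and on the answers
  received so far.\<close>

definition is_algorithm ::
  "'w measure \<Rightarrow> nat \<Rightarrow> real \<Rightarrow> (nat \<Rightarrow> 'w \<Rightarrow> answers \<Rightarrow> real) \<Rightarrow> ('w \<Rightarrow> answers \<Rightarrow> real) \<Rightarrow> bool" where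
  "is_algorithm \<Omega> N x0 q out \<longleftrightarrow>
     (\<forall>k<N. (\<lambda>(w, y). q k w y) \<in> borel_measurable (\<Omega> \<Otimes>\<^sub>M (\<Pi>\<^sub>M j\<in>{..<k}. borel))) \<and>
     (\<forall>w\<in>space \<Omega>. q 0 w (\<lambda>_. undefined) = x0) \<and>
     (\<lambda>(w, y). out w y) \<in> borel_measurable (\<Omega> \<Otimes>\<^sub>M (\<Pi>\<^sub>M j\<in>{..<N}. borel))"

text \<open>\<open>run q g w z k\<close> is the tuple of the first \<open>k\<close> noisy oracle answers when the internal
  randomness is \<open>w\<close> and the noise values are \<open>z 0, z 1, \<dots>\<close>.\<close>

primrec run ::
  "(nat \<Rightarrow> 'w \<Rightarrow> answers \<Rightarrow> real) \<Rightarrow> (real \<Rightarrow> real) \<Rightarrow> 'w \<Rightarrow> (nat \<Rightarrow> real) \<Rightarrow> nat \<Rightarrow> answers" where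
  "run q g w z 0 = (\<lambda>_. undefined)"
| "run q g w z (Suc k) = (run q g w z k)(k := g (q k w (run q g w z k)) + z k)"

text \<open>\<open>W\<close> is the internal randomness and \<open>e 0, \<dots>, e (N - 1)\<close> is the noise, all realised on a common
  probability space \<open>P\<close>. Independence of \<open>W\<close> from the noise vector is that of the generated
  sigma-algebras, since \<open>indep_var\<close> requires both variables to have the same type.\<close>

definition gaussian_noise_model ::
  "'p measure \<Rightarrow> 'w measure \<Rightarrow> ('p \<Rightarrow> 'w) \<Rightarrow> nat \<Rightarrow> real \<Rightarrow> (nat \<Rightarrow> 'p \<Rightarrow> real) \<Rightarrow> bool" where
  "gaussian_noise_model P \<Omega> W N s e \<longleftrightarrow>
     prob_space P \<and>
     W \<in> measurable P \<Omega> \<and>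
     (\<forall>k<N. distributed P lborel (e k) (normal_density 0 s)) \<and>
     prob_space.indep_vars P (\<lambda>_. borel) e {..<N} \<and>
     prob_space.indep_set P
       (sets (vimage_algebra (space P) W \<Omega>))
       (sets (vimage_algebra (space P) (\<lambda>p. \<lambda>k\<in>{..<N}. e k p) (\<Pi>\<^sub>M k\<in>{..<N}. borel)))"

definition failure_prob ::
  "'p measure \<Rightarrow> ('p \<Rightarrow> 'w) \<Rightarrow> (nat \<Rightarrow> 'p \<Rightarrow> real) \<Rightarrow> nat \<Rightarrow>
   (nat \<Rightarrow> 'w \<Rightarrow> answers \<Rightarrow> real) \<Rightarrow> ('w \<Rightarrow> answers \<Rightarrow> real) \<Rightarrow>
   real \<Rightarrow> (real \<Rightarrow> real) \<Rightarrow> (real \<Rightarrow> real) \<Rightarrow> real" where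
  "failure_prob P W e N q out \<epsilon> f g =
     measure P {p \<in> space P. f (out (W p) (run q g (W p) (\<lambda>k. e k p) N)) - min_value f \<ge> \<epsilon>}"

text \<open>\<open>- log p\<close> with value \<open>\<infinity>\<close> at \<open>0\<close> (whereas \<^term>\<open>ln (0::real)\<close> is \<open>0\<close>).\<close>

definition neg_ln :: "real \<Rightarrow> ereal" where
  "neg_ln p = (if p \<le> 0 then \<infinity> else ereal (- ln p))"

definition error_exponent ::
  "'p measure \<Rightarrow> ('p \<Rightarrow> 'w) \<Rightarrow> (nat \<Rightarrow> 'p \<Rightarrow> real) \<Rightarrow> nat \<Rightarrow>
   (nat \<Rightarrow> 'w \<Rightarrow> answers \<Rightarrow> real) \<Rightarrow> ('w \<Rightarrow> answers \<Rightarrow> real) \<Rightarrow>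
   real \<Rightarrow> real \<Rightarrow> real \<Rightarrow> real \<Rightarrow> ereal" where
  "error_exponent P W e N q out x0 R L \<epsilon> =
     neg_ln (Sup {failure_prob P W e N q out \<epsilon> f g | f g.
                    f \<in> problem_class x0 R L \<and> subgradient_selection f g})"

end

theory Submission
  imports Defs
begin

text \<open>The hard instances are \<open>f x = a * \<bar>x - c\<bar>\<close> with \<open>a = \<epsilon> / R\<close> and \<open>c = x0 \<plusminus> R\<close>: every output fails
  by \<open>\<epsilon>\<close> on one of them, according to its side of \<open>x0\<close>. The selected subgradients are \<open>\<plusminus>a\<close> everywhere,
  also at the kink, so relative to the reference law under which the answers are pure noise both
  laws of the answers have likelihood ratio \<open>exp (D / s\<^sup>2 - K)\<close>, where \<open>D\<close> is the sum of the
  products of subgradients and answers and has second moment \<open>N a\<^sup>2 s\<^sup>2 = 2 K s\<^sup>4\<close> under the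
  reference law. By Chebyshev, \<open>D < - s\<^sup>2 sqrt (6 K)\<close> has reference probability at most \<open>1/3\<close>; the
  failure events of the two instances have reference probabilities summing to at least \<open>1\<close>, so
  their true failure probabilities sum to at least \<open>(1 - 2/3) exp (- K - sqrt (6 K))\<close>.\<close>

section \<open>Gaussian measures on the line and on finite tuples\<close>

definition gaussian :: "real \<Rightarrow> real measure" where
  "gaussian s = density lborel (\<lambda>x. ennreal (normal_density 0 s x))"

text \<open>Has two roles: the law of the noise, and the reference law under which the answers are
  pure noise.\<close>

definition gaussian_vec :: "real \<Rightarrow> nat \<Rightarrow> answers measure" where
  "gaussian_vec s n = (\<Pi>\<^sub>M k\<in>{..<n}. gaussian s)"

lemma sets_gaussian [simp, measurable_cong]: "sets (gaussian s) = sets borel"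
  by (simp add: gaussian_def)

lemma space_gaussian [simp]: "space (gaussian s) = UNIV"
  by (simp add: gaussian_def)

lemma sets_gaussian_vec [simp, measurable_cong]:
  "sets (gaussian_vec s n) = sets (\<Pi>\<^sub>M k\<in>{..<n}. borel)"
  unfolding gaussian_vec_def by (intro sets_PiM_cong) auto

lemma space_gaussian_vec [simp]:
  "space (gaussian_vec s n) = space (\<Pi>\<^sub>M k\<in>{..<n}. borel :: real measure)"
  by (rule sets_eq_imp_space_eq) simp

lemma prob_space_gaussian: "s > 0 \<Longrightarrow> prob_space (gaussian s)"
  unfolding gaussian_def by (rule prob_space_normal_density)

lemma prob_space_gaussian_vec: "s > 0 \<Longrightarrow> prob_space (gaussian_vec s n)"
  unfolding gaussian_vec_def by (intro prob_space_PiM prob_space_gaussian)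

lemma measurable_fun_upd_PiM:
  assumes "f \<in> M \<rightarrow>\<^sub>M (\<Pi>\<^sub>M j\<in>{..<n}. borel)" and "g \<in> borel_measurable M"
  shows "(\<lambda>x. (f x)(n := g x)) \<in> M \<rightarrow>\<^sub>M (\<Pi>\<^sub>M j\<in>{..<Suc n}. borel)"
proof -
  have "(\<lambda>x. (f x, g x)) \<in> M \<rightarrow>\<^sub>M (\<Pi>\<^sub>M j\<in>{..<n}. borel) \<Otimes>\<^sub>M borel"
    using assms by measurable
  from measurable_compose[OF this measurable_add_dim[of n "{..<n}" "\<lambda>_. borel"]]
  show ?thesis by (simp add: lessThan_Suc)
qed

text \<open>Tonelli's theorem for the last coordinate. It drives the inductions over the number of
  queries in \<open>second_moment_correlation\<close> and \<open>nn_integral_run\<close>.\<close>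

lemma nn_integral_gaussian_vec_Suc:
  assumes "s > 0" and h: "h \<in> borel_measurable (\<Pi>\<^sub>M j\<in>{..<Suc n}. borel)"
  shows "(\<integral>\<^sup>+y. h y \<partial>gaussian_vec s (Suc n)) =
    (\<integral>\<^sup>+y. (\<integral>\<^sup>+t. h (y(n := t)) \<partial>gaussian s) \<partial>gaussian_vec s n)"
proof -
  interpret prob_space "gaussian s" by (rule prob_space_gaussian[OF assms(1)])
  interpret product_sigma_finite "\<lambda>_::nat. gaussian s" by unfold_locales
  have "h \<in> borel_measurable (gaussian_vec s (Suc n))" using h by simp
  then have "h \<in> borel_measurable (Pi\<^sub>M (insert n {..<n}) (\<lambda>_. gaussian s))"
    by (simp only: gaussian_vec_def lessThan_Suc)
  from product_nn_integral_insert[OF _ _ this] show ?thesis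
    by (simp add: gaussian_vec_def lessThan_Suc)
qed

text \<open>The Cameron-Martin formula on the line: substituting \<open>u = c + t\<close> moves the
  shift into the density, and expanding \<open>(u - c)\<^sup>2\<close> yields the exponential
  factor.\<close>

lemma nn_integral_gaussian_shift:
  assumes s: "s > 0" and [measurable]: "h \<in> borel_measurable borel"
  shows "(\<integral>\<^sup>+t. h (c + t) \<partial>gaussian s) =
    (\<integral>\<^sup>+u. h u * ennreal (exp ((c * u - c\<^sup>2 / 2) / s\<^sup>2)) \<partial>gaussian s)"
proof -
  have dens: "normal_density 0 s (- c + u) =
      normal_density 0 s u * exp ((c * u - c\<^sup>2 / 2) / s\<^sup>2)" for u
    using s by (simp add: normal_density_def exp_add[symmetric])
      (simp add: field_simps power2_eq_square)
  have "(\<integral>\<^sup>+t. h (c + t) \<partial>gaussian s) =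
      (\<integral>\<^sup>+t. ennreal (normal_density 0 s t) * h (c + t) \<partial>lborel)"
    unfolding gaussian_def by (subst nn_integral_density) auto
  also have "\<dots> = (\<integral>\<^sup>+u. ennreal (normal_density 0 s (- c + u)) * h u \<partial>lborel)"
    by (subst nn_integral_real_affine[where c = 1 and t = "- c"]) auto
  also have "\<dots> = (\<integral>\<^sup>+u. h u * ennreal (exp ((c * u - c\<^sup>2 / 2) / s\<^sup>2)) \<partial>gaussian s)"
    unfolding gaussian_def dens by (subst nn_integral_density) (auto simp: ennreal_mult mult_ac)
  finally show ?thesis .
qed

text \<open>The cross term vanishes because the noise is centred. In the application
  \<open>m\<close> is the correlation so far and \<open>c\<close> the next subgradient.\<close>

lemma nn_integral_gaussian_affine_square:
  assumes s: "s > 0"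
  shows "(\<integral>\<^sup>+t. ennreal ((m + c * t)\<^sup>2) \<partial>gaussian s) = ennreal (m\<^sup>2 + c\<^sup>2 * s\<^sup>2)"
proof -
  have 0: "has_bochner_integral lborel (\<lambda>x. normal_density 0 s x * m\<^sup>2) (m\<^sup>2)"
    using has_bochner_integral_mult_left[OF normal_moment_even[OF s, of 0 0], of "m\<^sup>2"] by simp
  have 1: "has_bochner_integral lborel (\<lambda>x. normal_density 0 s x * x * (2 * m * c)) 0"
    using has_bochner_integral_mult_left[OF normal_moment_odd[OF s, of 0 0], of "2 * m * c"] by simp
  have 2: "has_bochner_integral lborel (\<lambda>x. normal_density 0 s x * x\<^sup>2 * c\<^sup>2) (s\<^sup>2 * c\<^sup>2)"
    using has_bochner_integral_mult_left[OF normal_moment_even[OF s, of 0 1], of "c\<^sup>2"]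
    by (simp add: fact_2)
  have "(\<lambda>x. normal_density 0 s x * m\<^sup>2 + normal_density 0 s x * x * (2 * m * c) +
      normal_density 0 s x * x\<^sup>2 * c\<^sup>2) = (\<lambda>x. normal_density 0 s x * (m + c * x)\<^sup>2)"
    by (auto simp: fun_eq_iff power2_eq_square algebra_simps)
  with has_bochner_integral_add[OF has_bochner_integral_add[OF 0 1] 2]
  have hb: "has_bochner_integral lborel (\<lambda>x. normal_density 0 s x * (m + c * x)\<^sup>2) (m\<^sup>2 + c\<^sup>2 * s\<^sup>2)"
    by (simp add: mult.commute)
  have "(\<integral>\<^sup>+t. ennreal ((m + c * t)\<^sup>2) \<partial>gaussian s) =
      (\<integral>\<^sup>+t. ennreal (normal_density 0 s t * (m + c * t)\<^sup>2) \<partial>lborel)"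
    unfolding gaussian_def by (subst nn_integral_density) (auto simp: ennreal_mult)
  also have "\<dots> = ennreal (m\<^sup>2 + c\<^sup>2 * s\<^sup>2)"
    using hb by (subst nn_integral_eq_integral)
      (auto simp: has_bochner_integral_iff)
  finally show ?thesis .
qed

section \<open>The correlation of subgradients and answers, and its second moment\<close>

text \<open>The sum \<open>D\<close> of the overview, a martingale transform: the coefficient of
  \<open>y k\<close> depends only on the answers before it. The restriction cuts a longer tuple down
  to an element of the space over \<open>{..<k}\<close>, where \<open>c k\<close> is assumed
  measurable.\<close>

definition correlation :: "(nat \<Rightarrow> answers \<Rightarrow> real) \<Rightarrow> nat \<Rightarrow> answers \<Rightarrow> real" where
  "correlation c n y = (\<Sum>k<n. c k (restrict y {..<k}) * y k)"

text \<open>Every restriction stops before coordinate \<open>n\<close>, so the update touches only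
  the new last term. The hypothesis on \<open>y\<close> gives
  \<open>restrict y {..<n} = y\<close>.\<close>

lemma correlation_Suc:
  assumes y: "y \<in> space (\<Pi>\<^sub>M j\<in>{..<n}. borel :: real measure)"
  shows "correlation c (Suc n) (y(n := t)) = correlation c n y + c n y * t"
proof -
  have "restrict (y(n := t)) {..<k} = restrict y {..<k}" if "k \<le> n" for k
    using that by (auto simp: restrict_def fun_eq_iff)
  moreover have "restrict y {..<n} = y"
    using y by (auto simp: space_PiM PiE_def extensional_restrict)
  ultimately show ?thesis
    by (simp add: correlation_def)
qed

lemma measurable_correlation:
  assumes "\<And>k. k < n \<Longrightarrow> c k \<in> borel_measurable (\<Pi>\<^sub>M j\<in>{..<k}. borel)"
  shows "correlation c n \<in> borel_measurable (\<Pi>\<^sub>M j\<in>{..<n}. borel)"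
  unfolding correlation_def
proof (intro borel_measurable_sum borel_measurable_times)
  fix k assume "k \<in> {..<n}"
  then show "(\<lambda>y. c k (restrict y {..<k})) \<in> borel_measurable (\<Pi>\<^sub>M j\<in>{..<n}. borel)"
    using assms by (intro measurable_compose[OF measurable_restrict_subset]) auto
  show "(\<lambda>y. y k) \<in> borel_measurable (\<Pi>\<^sub>M j\<in>{..<n}. borel)"
    using \<open>k \<in> {..<n}\<close> by measurable
qed

text \<open>Under pure noise the increments are orthogonal: given the earlier answers, the next one
  has mean zero and variance \<open>s\<^sup>2\<close>, so each query adds
  \<open>a\<^sup>2 * s\<^sup>2\<close>.\<close>

lemma second_moment_correlation:
  assumes s: "s > 0"
    and c: "\<And>k. k < n \<Longrightarrow> c k \<in> borel_measurable (\<Pi>\<^sub>M j\<in>{..<k}. borel)"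
    and a: "\<And>k y. k < n \<Longrightarrow> (c k y)\<^sup>2 = a\<^sup>2"
  shows "(\<integral>\<^sup>+y. ennreal ((correlation c n y)\<^sup>2) \<partial>gaussian_vec s n) = ennreal (n * (a\<^sup>2 * s\<^sup>2))"
  using c a
proof (induction n)
  case 0
  then show ?case by (simp add: correlation_def)
next
  case (Suc n)
  interpret prob_space "gaussian_vec s n" by (rule prob_space_gaussian_vec[OF s])
  have [measurable]: "correlation c (Suc n) \<in> borel_measurable (\<Pi>\<^sub>M j\<in>{..<Suc n}. borel)"
      "correlation c n \<in> borel_measurable (\<Pi>\<^sub>M j\<in>{..<n}. borel)"
    using Suc.prems(1) by (auto intro!: measurable_correlation)
  have "(\<integral>\<^sup>+y. ennreal ((correlation c (Suc n) y)\<^sup>2) \<partial>gaussian_vec s (Suc n)) =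
      (\<integral>\<^sup>+y. (\<integral>\<^sup>+t. ennreal ((correlation c (Suc n) (y(n := t)))\<^sup>2) \<partial>gaussian s) \<partial>gaussian_vec s n)"
    by (rule nn_integral_gaussian_vec_Suc[OF s]) measurable
  also have "\<dots> = (\<integral>\<^sup>+y. ennreal ((correlation c n y)\<^sup>2) + ennreal (a\<^sup>2 * s\<^sup>2) \<partial>gaussian_vec s n)"
    by (intro nn_integral_cong)
      (simp add: correlation_Suc nn_integral_gaussian_affine_square[OF s] Suc.prems(2))
  also have "\<dots> = ennreal (n * (a\<^sup>2 * s\<^sup>2)) + ennreal (a\<^sup>2 * s\<^sup>2)"
    using Suc emeasure_space_1 by (subst nn_integral_add) auto
  also have "\<dots> = ennreal (Suc n * (a\<^sup>2 * s\<^sup>2))"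
    by (simp add: ennreal_plus[symmetric] algebra_simps del: ennreal_plus)
  finally show ?case .
qed

section \<open>Runs of the algorithm and their change of measure\<close>

lemma run_cong:
  "(\<And>k. k < n \<Longrightarrow> z k = z' k) \<Longrightarrow> run q g w z n = run q g w z' n"
  by (induction n) auto

text \<open>The length \<open>N\<close> of the noise tuple is kept apart from the number
  \<open>n\<close> of queries, so that the induction on \<open>n\<close> works over one fixed
  domain.\<close>

lemma measurable_run:
  assumes q: "\<And>k. k < n \<Longrightarrow>
      (\<lambda>(w, y). q k w y) \<in> borel_measurable (\<Omega> \<Otimes>\<^sub>M (\<Pi>\<^sub>M j\<in>{..<k}. borel))"
    and [measurable]: "g \<in> borel_measurable borel"
    and "n \<le> N"
  shows "(\<lambda>(w, z). run q g w z n) \<in> \<Omega> \<Otimes>\<^sub>M (\<Pi>\<^sub>M j\<in>{..<N}. borel) \<rightarrow>\<^sub>M (\<Pi>\<^sub>M j\<in>{..<n}. borel)"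
  using q \<open>n \<le> N\<close>
proof (induction n)
  case 0
  then show ?case by (simp add: split_beta' PiM_empty)
next
  case (Suc n)
  have [measurable]: "(\<lambda>x. run q g (fst x) (snd x) n) \<in>
      \<Omega> \<Otimes>\<^sub>M (\<Pi>\<^sub>M j\<in>{..<N}. borel) \<rightarrow>\<^sub>M (\<Pi>\<^sub>M j\<in>{..<n}. borel)"
    using Suc by (simp add: split_beta')
  have [measurable]: "n \<in> {..<N}" using Suc.prems by simp
  have [measurable]: "(\<lambda>(w, y). q n w y) \<in> borel_measurable (\<Omega> \<Otimes>\<^sub>M (\<Pi>\<^sub>M j\<in>{..<n}. borel))"
    using Suc.prems by simp
  have "(\<lambda>x. q n (fst x) (run q g (fst x) (snd x) n)) \<in>
      borel_measurable (\<Omega> \<Otimes>\<^sub>M (\<Pi>\<^sub>M j\<in>{..<N}. borel))"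
    using measurable_compose[of "\<lambda>x. (fst x, run q g (fst x) (snd x) n)" _ _ "\<lambda>(w, y). q n w y"]
    by simp
  note [measurable] = this
  show ?case
    unfolding split_beta' run.simps by (rule measurable_fun_upd_PiM) measurable
qed

lemma measurable_run_Pair:
  assumes "\<And>k. k < n \<Longrightarrow>
      (\<lambda>(w, y). q k w y) \<in> borel_measurable (\<Omega> \<Otimes>\<^sub>M (\<Pi>\<^sub>M j\<in>{..<k}. borel))"
    and "g \<in> borel_measurable borel" and w: "w \<in> space \<Omega>"
  shows "(\<lambda>z. run q g w z n) \<in> (\<Pi>\<^sub>M j\<in>{..<n}. borel) \<rightarrow>\<^sub>M (\<Pi>\<^sub>M j\<in>{..<n}. borel)"
  using measurable_compose[OF measurable_Pair1'[OF w] measurable_run[OF assms(1,2) order_refl]]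
  by simp

text \<open>Girsanov's formula in discrete time.\<close>

lemma nn_integral_run:
  fixes g :: "real \<Rightarrow> real"
  assumes s: "s > 0"
    and w: "w \<in> space \<Omega>"
    and q: "\<And>k. k < n \<Longrightarrow>
      (\<lambda>(w, y). q k w y) \<in> borel_measurable (\<Omega> \<Otimes>\<^sub>M (\<Pi>\<^sub>M j\<in>{..<k}. borel))"
    and g: "g \<in> borel_measurable borel"
    and a: "\<And>x. (g x)\<^sup>2 = a\<^sup>2"
    and h: "h \<in> borel_measurable (\<Pi>\<^sub>M j\<in>{..<n}. borel)"
  shows "(\<integral>\<^sup>+z. h (run q g w z n) \<partial>gaussian_vec s n) =
    (\<integral>\<^sup>+y. h y * ennreal (exp ((correlation (\<lambda>k y. g (q k w y)) n y - n * a\<^sup>2 / 2) / s\<^sup>2))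
       \<partial>gaussian_vec s n)"
  using q h
proof (induction n arbitrary: h)
  case 0
  then show ?case
    by (simp add: correlation_def gaussian_vec_def PiM_empty nn_integral_count_space_finite)
next
  case (Suc n)
  define c where "c k y = g (q k w y)" for k y
  \<comment> \<open>\<open>E n\<close> is the likelihood ratio after \<open>n\<close> answers;
    \<open>H\<close> averages \<open>h\<close> over the last noise value, given the first
    \<open>n\<close> answers.\<close>
  define E where "E n y = ennreal (exp ((correlation c n y - n * a\<^sup>2 / 2) / s\<^sup>2))" for n y
  define H where "H y = (\<integral>\<^sup>+t. h (y(n := c n y + t)) \<partial>gaussian s)" for y
  interpret G: prob_space "gaussian s" by (rule prob_space_gaussian[OF s])
  note [measurable] = Suc.prems(2) g
  have c [measurable]: "c k \<in> borel_measurable (\<Pi>\<^sub>M j\<in>{..<k}. borel)" if "k \<le> n" for k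
    unfolding c_def
    using measurable_compose[OF measurable_Pair1'[OF w] Suc.prems(1)[of k]] that
    by (intro measurable_compose[OF _ g]) simp
  have [measurable]: "correlation c (Suc n) \<in> borel_measurable (\<Pi>\<^sub>M j\<in>{..<Suc n}. borel)"
      "correlation c n \<in> borel_measurable (\<Pi>\<^sub>M j\<in>{..<n}. borel)"
    by (auto intro!: measurable_correlation c)
  have [measurable]: "c n \<in> borel_measurable (\<Pi>\<^sub>M j\<in>{..<n}. borel)" by simp
  have run_n [measurable]: "(\<lambda>z. run q g w z k) \<in> (\<Pi>\<^sub>M j\<in>{..<k}. borel) \<rightarrow>\<^sub>M (\<Pi>\<^sub>M j\<in>{..<k}. borel)"
    if "k \<le> Suc n" for k
    using Suc.prems(1) that by (intro measurable_run_Pair[where \<Omega> = \<Omega>] g w) auto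
  have run_upd: "run q g w (z(n := t)) (Suc n) =
      (run q g w z n)(n := c n (run q g w z n) + t)" for z t
    using run_cong[of n "z(n := t)" z q g w] by (simp add: c_def)
  have [measurable]: "(\<lambda>x. h ((fst x)(n := c n (fst x) + snd x))) \<in>
      borel_measurable ((\<Pi>\<^sub>M j\<in>{..<n}. borel) \<Otimes>\<^sub>M gaussian s)"
    by (rule measurable_compose[OF measurable_fun_upd_PiM Suc.prems(2)]) measurable
  have H: "H \<in> borel_measurable (\<Pi>\<^sub>M j\<in>{..<n}. borel)"
    unfolding H_def by (rule G.borel_measurable_nn_integral) (simp add: split_beta')
  have upd [measurable]: "(\<lambda>u. h (y(n := u))) \<in> borel_measurable borel"
    if "y \<in> space (\<Pi>\<^sub>M j\<in>{..<n}. borel)" for y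
    using that by (intro measurable_compose[OF measurable_fun_upd_PiM Suc.prems(2)]) auto
  \<comment> \<open>The one-dimensional shift by \<open>c n y\<close> contributes exactly the factor
    by which \<open>E (Suc n)\<close> differs from \<open>E n\<close>.\<close>
  have H_alt: "H y * E n y = (\<integral>\<^sup>+u. h (y(n := u)) * E (Suc n) (y(n := u)) \<partial>gaussian s)"
    if y: "y \<in> space (\<Pi>\<^sub>M j\<in>{..<n}. borel)" for y
  proof -
    have E: "E (Suc n) (y(n := u)) =
        ennreal (exp ((c n y * u - (c n y)\<^sup>2 / 2) / s\<^sup>2)) * E n y" for u
    proof -
      \<comment> \<open>The constant square of the subgradients enters here:
        \<open>(c n y)\<^sup>2\<close> equals \<open>a\<^sup>2\<close>, so the sum of squares in the
        exponent is deterministic.\<close>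
      have "correlation c (Suc n) (y(n := u)) - Suc n * a\<^sup>2 / 2 =
          (c n y * u - (c n y)\<^sup>2 / 2) + (correlation c n y - n * a\<^sup>2 / 2)"
        using y a[of "q n w y"] by (simp add: correlation_Suc c_def field_simps)
      then show ?thesis
        by (simp only: E_def add_divide_distrib[of _ _ "s\<^sup>2"] exp_add ennreal_mult exp_ge_zero)
    qed
    have "H y = (\<integral>\<^sup>+u. h (y(n := u)) * ennreal (exp ((c n y * u - (c n y)\<^sup>2 / 2) / s\<^sup>2)) \<partial>gaussian s)"
      unfolding H_def by (rule nn_integral_gaussian_shift[OF s upd[OF y]])
    then show ?thesis
      unfolding E using upd[OF y] by (simp add: mult.assoc[symmetric] nn_integral_multc)
  qed
  have "(\<integral>\<^sup>+z. h (run q g w z (Suc n)) \<partial>gaussian_vec s (Suc n)) =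
      (\<integral>\<^sup>+z. H (run q g w z n) \<partial>gaussian_vec s n)"
    unfolding H_def run_upd[symmetric]
    by (rule nn_integral_gaussian_vec_Suc[OF s]) (rule measurable_compose[OF run_n Suc.prems(2)], simp)
  \<comment> \<open>The induction hypothesis is applied to \<open>H\<close> in place of
    \<open>h\<close>, which is why \<open>h\<close> is arbitrary in the induction.\<close>
  also have "\<dots> = (\<integral>\<^sup>+y. H y * E n y \<partial>gaussian_vec s n)"
    unfolding E_def c_def using Suc.prems(1) by (intro Suc.IH H) auto
  also have "\<dots> = (\<integral>\<^sup>+y. (\<integral>\<^sup>+u. h (y(n := u)) * E (Suc n) (y(n := u)) \<partial>gaussian s) \<partial>gaussian_vec s n)"
    by (intro nn_integral_cong) (simp add: H_alt)
  also have "\<dots> = (\<integral>\<^sup>+y. h y * E (Suc n) y \<partial>gaussian_vec s (Suc n))"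
    unfolding E_def by (rule nn_integral_gaussian_vec_Suc[OF s, symmetric]) measurable
  finally show ?case
    unfolding E_def c_def .
qed


text \<open>Off an event of reference probability at most \<open>1 / 3\<close>, the likelihood ratio
  is at least \<open>exp (- K - sqrt (6 * K))\<close>. The part of \<open>A\<close> outside that
  event therefore keeps at least this fraction of its reference mass.\<close>

lemma run_event_lower_bound:
  fixes g :: "real \<Rightarrow> real"
  assumes s: "s > 0"
    and w: "w \<in> space \<Omega>"
    and q: "\<And>k. k < n \<Longrightarrow>
      (\<lambda>(w, y). q k w y) \<in> borel_measurable (\<Omega> \<Otimes>\<^sub>M (\<Pi>\<^sub>M j\<in>{..<k}. borel))"
    and g: "g \<in> borel_measurable borel"
    and a: "\<And>x. (g x)\<^sup>2 = a\<^sup>2" "a > 0"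
    and n: "n > 0"
    and A [measurable]: "A \<in> sets (\<Pi>\<^sub>M j\<in>{..<n}. borel)"
    and K: "K = n * a\<^sup>2 / (2 * s\<^sup>2)"
  shows "exp (- K - sqrt (6 * K)) * (measure (gaussian_vec s n) A - 1 / 3) \<le>
    measure (gaussian_vec s n) {z \<in> space (gaussian_vec s n). run q g w z n \<in> A}"
proof -
  let ?G = "gaussian_vec s n"
  interpret prob_space ?G by (rule prob_space_gaussian_vec[OF s])
  define D where "D = correlation (\<lambda>k y. g (q k w y)) n"
  \<comment> \<open>With this threshold \<open>t / s\<^sup>2 = sqrt (6 * K)\<close>, and
    \<open>t\<^sup>2\<close> is three times the second moment of \<open>D\<close>, whence the bound
    \<open>1 / 3\<close> for \<open>B\<close>.\<close>
  define t where "t = s\<^sup>2 * sqrt (6 * K)"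
  define B where "B = {y \<in> space ?G. t\<^sup>2 \<le> (D y)\<^sup>2}"
  have K0: "K > 0" using K a(2) n s by simp
  have t0: "t > 0" using K0 s by (simp add: t_def)
  have "K * s\<^sup>2 = n * a\<^sup>2 / 2" using s by (simp add: K)
  moreover have "t\<^sup>2 = 6 * (K * s\<^sup>2) * s\<^sup>2"
    using K0 by (simp add: t_def power_mult_distrib power2_eq_square[of "s\<^sup>2"])
  ultimately have t2: "t\<^sup>2 = 3 * (n * (a\<^sup>2 * s\<^sup>2))" by simp
  have c: "(\<lambda>y. g (q k w y)) \<in> borel_measurable (\<Pi>\<^sub>M j\<in>{..<k}. borel)" if "k < n" for k
    using measurable_compose[OF measurable_Pair1'[OF w] q[OF that]]
    by (intro measurable_compose[OF _ g]) simp
  have [measurable]: "D \<in> borel_measurable (\<Pi>\<^sub>M j\<in>{..<n}. borel)"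
    unfolding D_def by (intro measurable_correlation c)
  have B [measurable]: "B \<in> sets ?G"
    unfolding B_def by measurable
  have run [measurable]: "(\<lambda>z. run q g w z n) \<in> (\<Pi>\<^sub>M j\<in>{..<n}. borel) \<rightarrow>\<^sub>M (\<Pi>\<^sub>M j\<in>{..<n}. borel)"
    by (rule measurable_run_Pair[OF q g w])
  have A': "A \<in> events" by simp
  have moment: "(\<integral>\<^sup>+y. ennreal ((D y)\<^sup>2) \<partial>?G) = ennreal (n * (a\<^sup>2 * s\<^sup>2))"
    unfolding D_def by (rule second_moment_correlation[OF s c a(1)])
  \<comment> \<open>Chebyshev's inequality.\<close>
  have "ennreal (t\<^sup>2) * emeasure ?G B = (\<integral>\<^sup>+y. ennreal (t\<^sup>2) * indicator B y \<partial>?G)"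
    by (rule nn_integral_cmult_indicator[OF B, symmetric])
  also have "\<dots> \<le> (\<integral>\<^sup>+y. ennreal ((D y)\<^sup>2) \<partial>?G)"
    by (intro nn_integral_mono) (auto simp: B_def indicator_def)
  finally have "t\<^sup>2 * measure ?G B \<le> n * (a\<^sup>2 * s\<^sup>2)"
    unfolding moment emeasure_eq_measure
    by (subst (asm) ennreal_mult[symmetric]) (auto simp: ennreal_le_iff)
  moreover have "n * (a\<^sup>2 * s\<^sup>2) > 0" using a(2) n s by simp
  ultimately have PB: "measure ?G B \<le> 1 / 3"
    using mult_le_cancel_left_pos[of "n * (a\<^sup>2 * s\<^sup>2)" "3 * measure ?G B" 1]
    unfolding t2 by (simp add: mult_ac)
  have "ennreal (exp (- K - sqrt (6 * K)) * measure ?G (A - B)) =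
      (\<integral>\<^sup>+y. ennreal (exp (- K - sqrt (6 * K))) * indicator (A - B) y \<partial>?G)"
    using A' B by (subst nn_integral_cmult_indicator) (auto simp: ennreal_mult emeasure_eq_measure)
  also have "\<dots> \<le> (\<integral>\<^sup>+y. indicator A y * ennreal (exp ((D y - n * a\<^sup>2 / 2) / s\<^sup>2)) \<partial>?G)"
  proof (rule nn_integral_mono)
    fix y assume y: "y \<in> space ?G"
    \<comment> \<open>The exponent is \<open>D y / s\<^sup>2 - K\<close>, and off \<open>B\<close>
      one has \<open>D y > - t\<close>.\<close>
    have "- K - sqrt (6 * K) \<le> (D y - n * a\<^sup>2 / 2) / s\<^sup>2" if "y \<notin> B"
    proof -
      have "\<bar>D y\<bar> < t"
        using that y t0 by (auto simp: B_def abs_le_square_iff[symmetric] not_le)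
      then have "- t / s\<^sup>2 \<le> D y / s\<^sup>2"
        using s by (intro divide_right_mono) auto
      then show ?thesis
        using s by (simp add: t_def K diff_divide_distrib)
    qed
    then show "ennreal (exp (- K - sqrt (6 * K))) * indicator (A - B) y \<le>
        indicator A y * ennreal (exp ((D y - n * a\<^sup>2 / 2) / s\<^sup>2))"
      by (auto simp: indicator_def)
  qed
  also have "\<dots> = (\<integral>\<^sup>+z. indicator A (run q g w z n) \<partial>?G)"
    unfolding D_def by (rule nn_integral_run[OF s w q g a(1), symmetric]) auto
  also have "\<dots> = (\<integral>\<^sup>+z. indicator {z \<in> space ?G. run q g w z n \<in> A} z \<partial>?G)"
    by (intro nn_integral_cong) (auto simp: indicator_def)
  also have "\<dots> = emeasure ?G {z \<in> space ?G. run q g w z n \<in> A}"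
    by (intro nn_integral_indicator) measurable
  finally have "exp (- K - sqrt (6 * K)) * measure ?G (A - B) \<le>
      measure ?G {z \<in> space ?G. run q g w z n \<in> A}"
    by (simp add: emeasure_eq_measure)
  moreover have "measure ?G A - 1 / 3 \<le> measure ?G (A - B)"
  proof -
    have "measure ?G A \<le> measure ?G ((A - B) \<union> B)"
      using A' B by (intro finite_measure_mono) auto
    also have "\<dots> \<le> measure ?G (A - B) + measure ?G B"
      using A' B by (intro measure_Un_le) auto
    finally show ?thesis using PB by simp
  qed
  ultimately show ?thesis
    by (meson exp_ge_zero mult_left_mono order_trans)
qed

section \<open>Joint law of the internal randomness and the noise\<close>

text \<open>Independence of the generated sigma-algebras factorizes the joint law on rectangles, and
  these determine the product measure. Probabilities on the abstract space \<open>P\<close> thus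
  become iterated integrals over randomness and noise.\<close>

lemma gaussian_noise_model_distr:
  assumes model: "gaussian_noise_model P \<Omega> W N s e" and s: "s > 0" and N: "N \<ge> 1"
  shows "(\<lambda>p. (W p, \<lambda>k\<in>{..<N}. e k p)) \<in> P \<rightarrow>\<^sub>M \<Omega> \<Otimes>\<^sub>M (\<Pi>\<^sub>M k\<in>{..<N}. borel)"
    and "distr P (\<Omega> \<Otimes>\<^sub>M (\<Pi>\<^sub>M k\<in>{..<N}. borel)) (\<lambda>p. (W p, \<lambda>k\<in>{..<N}. e k p)) =
      distr P \<Omega> W \<Otimes>\<^sub>M gaussian_vec s N"
proof -
  let ?\<Pi> = "\<Pi>\<^sub>M k\<in>{..<N}. (borel :: real measure)"
  let ?Z = "\<lambda>p. \<lambda>k\<in>{..<N}. e k p"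
  interpret prob_space P using model by (simp add: gaussian_noise_model_def)
  have W [measurable]: "W \<in> P \<rightarrow>\<^sub>M \<Omega>"
    and dist: "\<And>k. k < N \<Longrightarrow> distributed P lborel (e k) (normal_density 0 s)"
    and indep: "indep_vars (\<lambda>_. borel) e {..<N}"
    and indep_set: "indep_set (sets (vimage_algebra (space P) W \<Omega>))
      (sets (vimage_algebra (space P) ?Z ?\<Pi>))"
    using model by (auto simp: gaussian_noise_model_def)
  have e [measurable]: "e k \<in> borel_measurable P" if "k < N" for k
    using distributed_measurable[OF dist[OF that]] by simp
  have Z [measurable]: "?Z \<in> P \<rightarrow>\<^sub>M ?\<Pi>"
    by (intro measurable_restrict) simp
  show pair [measurable]: "(\<lambda>p. (W p, ?Z p)) \<in> P \<rightarrow>\<^sub>M \<Omega> \<Otimes>\<^sub>M ?\<Pi>"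
    by measurable
  have "distr P borel (e k) = gaussian s" if "k < N" for k
  proof -
    have "distr P borel (e k) = distr P lborel (e k)"
      by (rule distr_cong) auto
    then show ?thesis
      using distributed_distr_eq_density[OF dist[OF that]] by (simp add: gaussian_def)
  qed
  then have "(\<Pi>\<^sub>M k\<in>{..<N}. distr P borel (e k)) = gaussian_vec s N"
    unfolding gaussian_vec_def by (intro PiM_cong) auto
  \<comment> \<open>Characterizing independence by a product law requires a nonempty index set,
    which \<open>N \<ge> 1\<close> provides.\<close>
  moreover have "distr P ?\<Pi> ?Z = (\<Pi>\<^sub>M k\<in>{..<N}. distr P borel (e k))"
    using N indep by (subst indep_vars_iff_distr_eq_PiM'[symmetric]) (auto simp: lessThan_empty_iff)
  ultimately have distr_Z: "distr P ?\<Pi> ?Z = gaussian_vec s N"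
    by simp
  interpret W: prob_space "distr P \<Omega> W" by (rule prob_space_distr) simp
  interpret G: prob_space "gaussian_vec s N" by (rule prob_space_gaussian_vec[OF s])
  show "distr P (\<Omega> \<Otimes>\<^sub>M ?\<Pi>) (\<lambda>p. (W p, ?Z p)) = distr P \<Omega> W \<Otimes>\<^sub>M gaussian_vec s N"
  proof (rule pair_measure_eqI[symmetric])
    show "sets (distr P \<Omega> W \<Otimes>\<^sub>M gaussian_vec s N) = sets (distr P (\<Omega> \<Otimes>\<^sub>M ?\<Pi>) (\<lambda>p. (W p, ?Z p)))"
      by (simp cong: sets_pair_measure_cong)
    fix A B assume "A \<in> sets (distr P \<Omega> W)" and "B \<in> sets (gaussian_vec s N)"
    then have A: "A \<in> sets \<Omega>" and B: "B \<in> sets ?\<Pi>" by auto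
    have "emeasure (gaussian_vec s N) B = emeasure P (?Z -` B \<inter> space P)"
      using B by (simp add: distr_Z[symmetric] emeasure_distr)
    moreover have "emeasure (distr P \<Omega> W) A = emeasure P (W -` A \<inter> space P)"
      using A by (simp add: emeasure_distr)
    moreover have "emeasure (distr P (\<Omega> \<Otimes>\<^sub>M ?\<Pi>) (\<lambda>p. (W p, ?Z p))) (A \<times> B) =
        emeasure P ((W -` A \<inter> space P) \<inter> (?Z -` B \<inter> space P))"
      using A B by (subst emeasure_distr[OF pair]) (auto intro!: arg_cong[where f = "emeasure P"])
    moreover have "prob ((W -` A \<inter> space P) \<inter> (?Z -` B \<inter> space P)) =
        prob (W -` A \<inter> space P) * prob (?Z -` B \<inter> space P)"
      using A B by (intro indep_setD[OF indep_set] in_vimage_algebra)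
    ultimately show "emeasure (distr P \<Omega> W) A * emeasure (gaussian_vec s N) B =
        emeasure (distr P (\<Omega> \<Otimes>\<^sub>M ?\<Pi>) (\<lambda>p. (W p, ?Z p))) (A \<times> B)"
      by (simp add: emeasure_eq_measure ennreal_mult)
  qed (unfold_locales)
qed

section \<open>Scaled distance functions as hard instances\<close>

text \<open>At the kink every value between \<open>- a\<close> and \<open>a\<close> is a
  subgradient; taking \<open>- a\<close> rather than \<open>0\<close> keeps the square equal to
  \<open>a\<^sup>2\<close> everywhere, as \<open>nn_integral_run\<close> demands.\<close>

definition sharp_sign :: "real \<Rightarrow> real \<Rightarrow> real \<Rightarrow> real" where
  "sharp_sign a c x = (if x \<le> c then - a else a)"

lemma convex_on_scaled_dist: "a \<ge> 0 \<Longrightarrow> convex_on UNIV (\<lambda>x::real. a * \<bar>x - c\<bar>)"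
proof (rule convex_onI)
  fix t x y :: real assume "a \<ge> 0" "0 < t" "t < 1"
  have "\<bar>(1 - t) * x + t * y - c\<bar> = \<bar>(1 - t) * (x - c) + t * (y - c)\<bar>"
    by (simp add: algebra_simps)
  also have "\<dots> \<le> (1 - t) * \<bar>x - c\<bar> + t * \<bar>y - c\<bar>"
    using \<open>0 < t\<close> \<open>t < 1\<close> abs_triangle_ineq[of "(1 - t) * (x - c)" "t * (y - c)"]
    by (simp add: abs_mult)
  finally have "a * \<bar>(1 - t) * x + t * y - c\<bar> \<le> a * ((1 - t) * \<bar>x - c\<bar> + t * \<bar>y - c\<bar>)"
    using \<open>a \<ge> 0\<close> by (rule mult_left_mono)
  then show "a * \<bar>(1 - t) *\<^sub>R x + t *\<^sub>R y - c\<bar> \<le> (1 - t) * (a * \<bar>x - c\<bar>) + t * (a * \<bar>y - c\<bar>)"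
    by (simp add: algebra_simps)
qed simp

lemma is_arg_min_scaled_dist_iff:
  "a > 0 \<Longrightarrow> is_arg_min (\<lambda>x::real. a * \<bar>x - c\<bar>) (\<lambda>_. True) x \<longleftrightarrow> x = c"
  by (auto simp: is_arg_min_def mult_less_0_iff not_less dest: spec[of _ c])

text \<open>\<open>min_value\<close> goes through the choice operator in \<open>arg_min\<close>;
  uniqueness of the minimizer \<open>c\<close> pins the choice down.\<close>

lemma min_value_scaled_dist:
  assumes "a > 0" shows "min_value (\<lambda>x. a * \<bar>x - c\<bar>) = 0"
proof -
  have "is_arg_min (\<lambda>x. a * \<bar>x - c\<bar>) (\<lambda>_. True) = (\<lambda>x. x = c)"
    using is_arg_min_scaled_dist_iff[OF assms] by (intro ext)
  then show ?thesis by (simp add: min_value_def arg_min_def)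
qed

lemma scaled_dist_in_problem_class:
  assumes a: "0 < a" "a \<le> L" and c: "\<bar>x0 - c\<bar> \<le> R"
  shows "(\<lambda>x. a * \<bar>x - c\<bar>) \<in> problem_class x0 R L"
proof -
  have "\<bar>v\<bar> \<le> L" if "v \<in> subdifferential (\<lambda>x. a * \<bar>x - c\<bar>) x" for v x
  proof -
    \<comment> \<open>Moving by \<open>sgn v\<close> turns the linear term of the subgradient
      inequality into \<open>\<bar>v\<bar>\<close>, while the function grows by at most
      \<open>a\<close>.\<close>
    have *: "a * \<bar>x + sgn v - c\<bar> \<ge> a * \<bar>x - c\<bar> + \<bar>v\<bar>"
      using that by (auto simp: subdifferential_def abs_sgn mult.commute dest: spec[of _ "x + sgn v"])
    have "\<bar>x + sgn v - c\<bar> \<le> \<bar>x - c\<bar> + 1"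
      by (auto simp: sgn_if)
    then have "a * \<bar>x + sgn v - c\<bar> \<le> a * (\<bar>x - c\<bar> + 1)"
      using a by (intro mult_left_mono) auto
    then show ?thesis using * a by (simp add: algebra_simps)
  qed
  then show ?thesis
    using a c by (auto simp: problem_class_def convex_on_scaled_dist is_arg_min_scaled_dist_iff)
qed

lemma subgradient_selection_sharp_sign:
  assumes "a > 0"
  shows "subgradient_selection (\<lambda>x. a * \<bar>x - c\<bar>) (sharp_sign a c)"
proof -
  have "sharp_sign a c x \<in> subdifferential (\<lambda>x. a * \<bar>x - c\<bar>) x" for x
  proof -
    have "a * (c - y) \<le> a * \<bar>y - c\<bar>" "a * (y - c) \<le> a * \<bar>y - c\<bar>" for y
      using assms by (auto intro!: mult_left_mono)
    then show ?thesis
      by (auto simp: subdifferential_def sharp_sign_def algebra_simps)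
  qed
  moreover have "sharp_sign a c \<in> borel_measurable borel"
    unfolding sharp_sign_def by measurable
  ultimately show ?thesis by (simp add: subgradient_selection_def)
qed

section \<open>From the two instances to the error exponent\<close>

lemma neg_ln_le:
  assumes "exp (- b) \<le> p" shows "neg_ln p \<le> ereal b"
proof -
  have "p > 0" using assms exp_gt_zero less_le_trans by blast
  then show ?thesis
    using assms ln_ge_iff[of p "- b"] by (simp add: neg_ln_def)
qed

theorem theorem2:
  fixes x0 R L s \<epsilon> K :: real and N :: nat
    and P :: "'p measure" and \<Omega> :: "'w measure" and W :: "'p \<Rightarrow> 'w" and e :: "nat \<Rightarrow> 'p \<Rightarrow> real"
    and q :: "nat \<Rightarrow> 'w \<Rightarrow> answers \<Rightarrow> real" and out :: "'w \<Rightarrow> answers \<Rightarrow> real"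
  assumes "R > 0" and "L > 0" and "s > 0" and "N \<ge> 1"
    and "0 < \<epsilon>" and "\<epsilon> \<le> R * L"
    and "gaussian_noise_model P \<Omega> W N s e"
    and "is_algorithm \<Omega> N x0 q out"
    and "K = \<epsilon>\<^sup>2 * real N / (2 * R\<^sup>2 * s\<^sup>2)"
  shows "error_exponent P W e N q out x0 R L \<epsilon> \<le> ereal (K + sqrt (6 * K) + ln 6)"
proof -
  \<comment> \<open>This slope makes the excess at distance \<open>R\<close> from the minimizer
    equal to \<epsilon>; the hypothesis \<open>\<epsilon> \<le> R * L\<close> says that it is at
    most \<open>L\<close>.\<close>
  define a where "a = \<epsilon> / R"
  define f where "f c x = a * \<bar>x - c\<bar>" for c x :: real
  let ?g = "sharp_sign a"
  let ?G = "gaussian_vec s N"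
  let ?\<Pi> = "\<Pi>\<^sub>M k\<in>{..<N}. (borel :: real measure)"
  let ?\<mu> = "distr P \<Omega> W"
  let ?E = "exp (- K - sqrt (6 * K))"
  note s = \<open>s > 0\<close>
  have a: "a > 0" "a \<le> L" and aR: "a * R = \<epsilon>"
    using assms by (auto simp: a_def field_simps)
  have K: "K = N * a\<^sup>2 / (2 * s\<^sup>2)"
    using assms by (simp add: a_def power_divide field_simps)
  interpret P: prob_space P using assms by (simp add: gaussian_noise_model_def)
  interpret G: prob_space ?G by (rule prob_space_gaussian_vec[OF s])
  have q: "(\<lambda>(w, y). q k w y) \<in> borel_measurable (\<Omega> \<Otimes>\<^sub>M (\<Pi>\<^sub>M j\<in>{..<k}. borel))" if "k < N" for k
    using assms that by (simp add: is_algorithm_def)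
  have out: "(\<lambda>(w, y). out w y) \<in> borel_measurable (\<Omega> \<Otimes>\<^sub>M ?\<Pi>)"
    using assms by (simp add: is_algorithm_def)
  have "W \<in> P \<rightarrow>\<^sub>M \<Omega>" using assms by (simp add: gaussian_noise_model_def)
  then interpret \<mu>: prob_space ?\<mu> by (rule P.prob_space_distr)
  have g: "?g c \<in> borel_measurable borel" for c
    using subgradient_selection_sharp_sign[OF a(1)] by (simp add: subgradient_selection_def)
  have g2: "(?g c x)\<^sup>2 = a\<^sup>2" for c x
    by (simp add: sharp_sign_def)
  have [measurable]: "f c \<in> borel_measurable borel" for c
    unfolding f_def by measurable

  \<comment> \<open>The failure event as a set of pairs of randomness and noise; its sections at
    fixed \<open>w\<close> have the form treated in \<open>run_event_lower_bound\<close>.\<close>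
  define X where "X c = {x \<in> space (\<Omega> \<Otimes>\<^sub>M ?\<Pi>).
    \<epsilon> \<le> f c (out (fst x) (run q (?g c) (fst x) (snd x) N))}" for c
  have [measurable]: "(\<lambda>x. run q (?g c) (fst x) (snd x) N) \<in> \<Omega> \<Otimes>\<^sub>M ?\<Pi> \<rightarrow>\<^sub>M ?\<Pi>" for c
    using measurable_run[OF q g order_refl] by (simp add: split_beta')
  have "(\<lambda>x. out (fst x) (run q (?g c) (fst x) (snd x) N)) \<in> borel_measurable (\<Omega> \<Otimes>\<^sub>M ?\<Pi>)" for c
    using measurable_compose[OF _ out, of "\<lambda>x. (fst x, run q (?g c) (fst x) (snd x) N)"] by simp
  note [measurable] = this
  have X [measurable]: "X c \<in> sets (\<Omega> \<Otimes>\<^sub>M ?\<Pi>)" for c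
    unfolding X_def by measurable
  have failure: "ennreal (failure_prob P W e N q out \<epsilon> (f c) (?g c)) = (\<integral>\<^sup>+w. emeasure ?G (Pair w -` X c) \<partial>?\<mu>)" for c
  proof -
    let ?T = "\<lambda>p. (W p, \<lambda>k\<in>{..<N}. e k p)"
    note T = gaussian_noise_model_distr[OF assms(7) s assms(4)]
    have "run q (?g c) w (\<lambda>k. e k p) N = run q (?g c) w (\<lambda>k\<in>{..<N}. e k p) N" for w p
      by (rule run_cong) simp
    moreover have "min_value (f c) = 0"
      unfolding f_def by (rule min_value_scaled_dist[OF a(1)])
    ultimately have "failure_prob P W e N q out \<epsilon> (f c) (?g c) = measure P (?T -` X c \<inter> space P)"
      using measurable_space[OF T(1)]
      unfolding failure_prob_def X_def by (intro arg_cong[where f = "measure P"]) auto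
    then have "ennreal (failure_prob P W e N q out \<epsilon> (f c) (?g c)) = emeasure (?\<mu> \<Otimes>\<^sub>M ?G) (X c)"
      by (simp add: T(2)[symmetric] emeasure_distr[OF T(1)] P.emeasure_eq_measure)
    also have "\<dots> = (\<integral>\<^sup>+w. emeasure ?G (Pair w -` X c) \<partial>?\<mu>)"
      using X[of c] by (intro G.emeasure_pair_measure_alt) (simp cong: sets_pair_measure_cong)
    finally show ?thesis .
  qed

  \<comment> \<open>Conditionally on the internal randomness the algorithm is deterministic. The
    factor \<open>1 / 3\<close> is what remains of total reference mass at least \<open>1\<close>
    after losing \<open>1 / 3\<close> for each instance.\<close>
  have fixed: "ennreal (?E / 3) \<le>
      emeasure ?G (Pair w -` X (x0 + R)) + emeasure ?G (Pair w -` X (x0 - R))" if w: "w \<in> space \<Omega>" for w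
  proof -
    \<comment> \<open>Failure as a set of answers: for both instances it is measured under the same
      reference law.\<close>
    define A where "A c = {y \<in> space ?\<Pi>. \<epsilon> \<le> f c (out w y)}" for c
    have [measurable]: "out w \<in> borel_measurable ?\<Pi>"
      using measurable_compose[OF measurable_Pair1'[OF w] out] by simp
    have A: "A c \<in> sets ?\<Pi>" for c
      unfolding A_def by measurable
    have "run q (?g c) w z N \<in> space ?\<Pi>" if "z \<in> space ?\<Pi>" for z c
      using measurable_space[OF measurable_run_Pair[OF q g w] that] by simp
    then have "Pair w -` X c = {z \<in> space ?G. run q (?g c) w z N \<in> A c}" for c
      using w by (auto simp: X_def A_def space_pair_measure)
    then have bound: "?E * (measure ?G (A c) - 1 / 3) \<le> measure ?G (Pair w -` X c)" for c
      using run_event_lower_bound[OF s w q g g2 a(1) _ A K] assms(4) by simp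
    have "\<epsilon> \<le> f (x0 + R) x \<or> \<epsilon> \<le> f (x0 - R) x" for x
    proof (cases "x \<le> x0")
      case True
      then have "a * R \<le> a * \<bar>x - (x0 + R)\<bar>"
        using a \<open>R > 0\<close> by (intro mult_left_mono) auto
      then show ?thesis by (simp add: f_def aR)
    next
      case False
      then have "a * R \<le> a * \<bar>x - (x0 - R)\<bar>"
        using a \<open>R > 0\<close> by (intro mult_left_mono) auto
      then show ?thesis by (simp add: f_def aR)
    qed
    then have "A (x0 + R) \<union> A (x0 - R) = space ?G"
      by (auto simp: A_def)
    then have "1 \<le> measure ?G (A (x0 + R)) + measure ?G (A (x0 - R))"
      using measure_Un_le[of "A (x0 + R)" ?G "A (x0 - R)"] A G.prob_space by simp
    then have "?E * (1 / 3) \<le>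
        ?E * ((measure ?G (A (x0 + R)) - 1 / 3) + (measure ?G (A (x0 - R)) - 1 / 3))"
      by (intro mult_left_mono) auto
    also have "\<dots> \<le> measure ?G (Pair w -` X (x0 + R)) + measure ?G (Pair w -` X (x0 - R))"
      using bound[of "x0 + R"] bound[of "x0 - R"] by (simp only: distrib_left)
    finally show ?thesis
      by (simp add: G.emeasure_eq_measure ennreal_plus[symmetric] del: ennreal_plus)
  qed
  define F where "F c = failure_prob P W e N q out \<epsilon> (f c) (?g c)" for c
  have F0: "F c \<ge> 0" for c by (simp add: F_def failure_prob_def)
  have [measurable]: "(\<lambda>w. emeasure ?G (Pair w -` X c)) \<in> borel_measurable ?\<mu>" for c
    using X[of c] by (intro G.measurable_emeasure_Pair) (simp cong: sets_pair_measure_cong)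
  have "ennreal (?E / 3) = (\<integral>\<^sup>+w. ennreal (?E / 3) \<partial>?\<mu>)"
    using \<mu>.emeasure_space_1 by simp
  also have "\<dots> \<le> (\<integral>\<^sup>+w. emeasure ?G (Pair w -` X (x0 + R)) + emeasure ?G (Pair w -` X (x0 - R)) \<partial>?\<mu>)"
    using fixed by (intro nn_integral_mono) simp
  also have "\<dots> = ennreal (F (x0 + R) + F (x0 - R))"
    by (subst nn_integral_add) (auto simp: failure[symmetric] F_def[symmetric] F0)
  finally have "?E / 3 \<le> F (x0 + R) + F (x0 - R)"
    using F0[of "x0 + R"] F0[of "x0 - R"] by (subst (asm) ennreal_le_iff) auto
  \<comment> \<open>One of the two instances has at least half of the sum; this half and the factor
    \<open>1 / 3\<close> produce \<open>ln 6\<close>.\<close>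
  then have "?E / 6 \<le> F (x0 + R) \<or> ?E / 6 \<le> F (x0 - R)"
    by linarith
  then obtain c where c: "c = x0 + R \<or> c = x0 - R" and Fc: "?E / 6 \<le> F c"
    by blast
  let ?S = "{failure_prob P W e N q out \<epsilon> f g | f g.
    f \<in> problem_class x0 R L \<and> subgradient_selection f g}"
  have "f c \<in> problem_class x0 R L"
    unfolding f_def using c \<open>R > 0\<close> by (intro scaled_dist_in_problem_class a) auto
  moreover have "subgradient_selection (f c) (?g c)"
    unfolding f_def by (rule subgradient_selection_sharp_sign[OF a(1)])
  ultimately have "F c \<in> ?S"
    unfolding F_def by blast
  \<comment> \<open>A supremum of reals dominates its members only for a set bounded above.\<close>
  moreover have "bdd_above ?S"
    by (intro bdd_aboveI[of _ 1]) (auto simp: failure_prob_def)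
  ultimately have "F c \<le> Sup ?S"
    by (rule cSup_upper)
  moreover have "exp (- (K + sqrt (6 * K) + ln 6)) = ?E / 6"
    by (simp add: exp_diff exp_minus exp_add field_simps)
  ultimately show ?thesis
    unfolding error_exponent_def using Fc by (intro neg_ln_le) linarith
qed

end
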